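(* (Linear systems over a Prüfer domain, I.) Let $\mathbf{Z}$ be a Prüfer domain with explicit divisibility and field of fractions $\mathbf{K}$. Let $A=(\mathfrak{h}_1,\dots,\mathfrak{h}_n;\mathfrak{e}_1,\dots,\mathfrak{e}_m;\underline{A})$ and $B=(\mathfrak{h}_1,\dots,\mathfrak{h}_n;\mathfrak{b};\underline{B})$ be pseudo-matrices over $\mathbf{Z}$, $B$ having a single column, and consider the linear system $AX=B$ where the unknown $X=(\mathfrak{e}_1,\dots,\mathfrak{e}_m;\mathfrak{b};\underline{X})$ is a pseudo-matrix. 1. Particular case: suppose $m=n$, $\mathfrak{det}(A)\neq\langle 0\rangle$, and that the order-$1$ minor ideals of the column $B$ are all contained in $\mathfrak{det}(A)$. Then the solution $\underline{X}\in\mathbf{K}^n$ of $\underline{A}\,\underline{X}=\underline{B}$ computed in $\mathbf{K}$ gives a pseudo-matrix $X=(\underline{\mathfrak{e}};\mathfrak{b};\underline{X})$ over $\mathbf{Z}$; in other words $x_j\mathfrak{b}\subseteq\mathfrak{e}_j$ for $j=1,\dots,n$. 2. General case: the linear system has a solution if and only if the determinantal ideals of the pseudo-matrix $[A\mid B]=(\underline{\mathfrak{h}};\mathfrak{e}_1,\dots,\mathfrak{e}_m,\mathfrak{b};[\underline{A}\mid\underline{B}])$ are equal to those of $A$ (i.e. $\mathfrak{D}_r([A\mid B])=\mathfrak{D}_r(A)$ for all $r$).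
   Context: A Prüfer domain is an integral domain in which every nonzero finitely generated ideal is invertible. "Explicit divisibility" is a constructive convention: there is an algorithm deciding divisibility in $\mathbf{Z}$. Fractional ideals are finitely generated $\mathbf{Z}$-submodules of $\mathbf{K}$. A pseudo-matrix over $\mathbf{Z}$ is a triple $M=(\mathfrak{h}_1,\dots,\mathfrak{h}_n;\mathfrak{e}_1,\dots,\mathfrak{e}_m;\underline{M})$ with $\mathfrak{h}_i$ and $\mathfrak{e}_j$ invertible fractional ideals and $\underline{M}=(m_{ij})\in\mathbf{K}^{n\times m}$ satisfying $m_{ij}\mathfrak{e}_j\subseteq\mathfrak{h}_i$ for all $i,j$. The product is $(\underline{\mathfrak{c}};\underline{\mathfrak{h}};\underline{B})\cdot(\underline{\mathfrak{h}};\underline{\mathfrak{e}};\underline{A})=(\underline{\mathfrak{c}};\underline{\mathfrak{e}};\underline{B}\,\underline{A})$. If $m=n$, the determinant ideal is $\mathfrak{det}(M)=\det(\underline{M})\,\prod_j\mathfrak{e}_j\,\big(\prod_i\mathfrak{h}_i\big)^{-1}$ (an ideal of $\mathbf{Z}$). For increasing lists of $r$ row indices $\beta$ and $r$ column indices $\alpha$, the minor ideal of order $r$ is $\mathfrak{m}_{\beta,\alpha}(M)=\det(\underline{M}_{\beta,\alpha})\prod_{i=1}^r\mathfrak{e}_{\alpha_i}\big(\prod_{i=1}^r\mathfrak{h}_{\beta_i}\big)^{-1}$; for order $1$ it is $m_{ij}\mathfrak{e}_j\mathfrak{h}_i^{-1}$. The determinantal ideal $\mathfrak{D}_r(M)$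 is the sum of the minor ideals of order $r$ for $1\le r\le\min(m,n)$; $\mathfrak{D}_r(M)=0$ for $r>\min(m,n)$ and $\mathfrak{D}_r(M)=\langle1\rangle$ for $r\le0$. *)

theory Defs
  imports
    "Jordan_Normal_Form.Determinant"
    "HOL-Computational_Algebra.Polynomial_Factorial"
begin

section \<open>Fractional ideals\<close>

text \<open>The domain is the type \<^typ>\<open>'a\<close> of class \<^class>\<open>idom\<close>, its field of fractions is
  \<^typ>\<open>'a fract\<close>, and \<^const>\<open>to_fract\<close> is the embedding.\<close>

global_interpretation zmod: Modules.module "\<lambda>(a::'a::idom) (x::'a fract). to_fract a * x"
  defines zspan = zmod.span
  by unfold_locales (simp_all add: algebra_simps)

lemma zspan_mult_mem:
  assumes "x \<in> zspan S" "y \<in> zspan T"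
  shows "x * y \<in> zspan {s * t | s t. s \<in> S \<and> t \<in> T}"
proof -
  let ?U = "zspan {s * t | s t. s \<in> S \<and> t \<in> T}"
  have 1: "s * y \<in> ?U" if "s \<in> S" for s
    using assms(2)
  proof (induction rule: zmod.span_induct_alt)
    case base
    then show ?case by (simp add: zmod.span_zero)
  next
    case (step c t z)
    have "s * t \<in> ?U" by (rule zmod.span_base) (use that step in blast)
    then have "to_fract c * (s * t) + s * z \<in> ?U"
      using step by (intro zmod.span_add zmod.span_scale) auto
    then show ?case by (simp add: algebra_simps)
  qed
  from assms(1) show ?thesis
  proof (induction rule: zmod.span_induct_alt)
    case base
    then show ?case by (simp add: zmod.span_zero)
  next
    case (step c s z)
    have "to_fract c * (s * y) + z * y \<in> ?U"
      using step 1 by (intro zmod.span_add zmod.span_scale) auto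
    then show ?case by (simp add: algebra_simps)
  qed
qed

lemma zspan_mult_span:
  "zspan {x * y | x y. x \<in> zspan S \<and> y \<in> zspan T} = zspan {s * t | s t. s \<in> S \<and> t \<in> T}"
proof
  show "zspan {x * y | x y. x \<in> zspan S \<and> y \<in> zspan T} \<subseteq> zspan {s * t | s t. s \<in> S \<and> t \<in> T}"
    by (rule zmod.span_minimal) (auto intro: zspan_mult_mem)
  show "zspan {s * t | s t. s \<in> S \<and> t \<in> T} \<subseteq> zspan {x * y | x y. x \<in> zspan S \<and> y \<in> zspan T}"
    by (rule zmod.span_mono) (blast intro: zmod.span_base)
qed

typedef (overloaded) ('a::idom) frac_ideal =
  "{I :: 'a fract set. \<exists>S. finite S \<and> I = zspan S}"
  morphisms fi_set Abs_fi
  by (rule exI[of _ "zspan {}"]) blast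

setup_lifting type_definition_frac_ideal

lift_definition principal_fi :: "'a::idom fract \<Rightarrow> 'a frac_ideal" is "\<lambda>x. zspan {x}"
  by blast

instantiation frac_ideal :: (idom) "{comm_semiring_1, order}"
begin

lift_definition zero_frac_ideal :: "'a frac_ideal" is "{0}"
  by (rule exI[of _ "{}"]) simp

lift_definition one_frac_ideal :: "'a frac_ideal" is "range to_fract"
  by (rule exI[of _ "{1}"]) (simp add: zmod.span_singleton)

lift_definition plus_frac_ideal :: "'a frac_ideal \<Rightarrow> 'a frac_ideal \<Rightarrow> 'a frac_ideal"
  is "\<lambda>I J. {x + y | x y. x \<in> I \<and> y \<in> J}"
proof -
  fix I J :: "'a fract set"
  assume "\<exists>S. finite S \<and> I = zspan S" "\<exists>S. finite S \<and> J = zspan S"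
  then obtain S T where "finite S" "I = zspan S" "finite T" "J = zspan T" by blast
  then show "\<exists>S. finite S \<and> {x + y | x y. x \<in> I \<and> y \<in> J} = zspan S"
    by (intro exI[of _ "S \<union> T"]) (simp add: zmod.span_Un)
qed

lift_definition times_frac_ideal :: "'a frac_ideal \<Rightarrow> 'a frac_ideal \<Rightarrow> 'a frac_ideal"
  is "\<lambda>I J. zspan {x * y | x y. x \<in> I \<and> y \<in> J}"
proof -
  fix I J :: "'a fract set"
  assume "\<exists>S. finite S \<and> I = zspan S" "\<exists>S. finite S \<and> J = zspan S"
  then obtain S T where "finite S" "I = zspan S" "finite T" "J = zspan T" by blast
  then show "\<exists>S. finite S \<and> zspan {x * y | x y. x \<in> I \<and> y \<in> J} = zspan S"
    by (intro exI[of _ "{s * t | s t. s \<in> S \<and> t \<in> T}"])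
      (simp add: zspan_mult_span finite_image_set2)
qed

lift_definition less_eq_frac_ideal :: "'a frac_ideal \<Rightarrow> 'a frac_ideal \<Rightarrow> bool" is "(\<subseteq>)" .

lift_definition less_frac_ideal :: "'a frac_ideal \<Rightarrow> 'a frac_ideal \<Rightarrow> bool" is "(\<subset>)" .

instance
proof
  fix I J L :: "'a frac_ideal"
  show "(I + J) + L = I + (J + L)"
  proof transfer
    fix I J L :: "'a fract set"
    have "\<exists>x y. a + b + c = x + y \<and> x \<in> I \<and> (\<exists>u v. y = u + v \<and> u \<in> J \<and> v \<in> L)"
      if "a \<in> I" "b \<in> J" "c \<in> L" for a b c
      using that add.assoc by blast
    moreover have "\<exists>x y. a + (b + c) = x + y \<and> (\<exists>u v. x = u + v \<and> u \<in> I \<and> v \<in> J) \<and> y \<in> L"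
      if "a \<in> I" "b \<in> J" "c \<in> L" for a b c
      using that add.assoc[of a b c] by metis
    ultimately show "{x + y |x y. x \<in> {x + y |x y. x \<in> I \<and> y \<in> J} \<and> y \<in> L} =
        {x + y |x y. x \<in> I \<and> y \<in> {x + y |x y. x \<in> J \<and> y \<in> L}}"
      by auto
  qed
  show "I + J = J + I"
    by transfer (use add.commute in blast)
  show "0 + I = I"
    by transfer auto
  show "(I * J) * L = I * (J * L)"
  proof transfer
    fix I J L :: "'a fract set"
    assume "\<exists>S. finite S \<and> I = zspan S" "\<exists>S. finite S \<and> J = zspan S" "\<exists>S. finite S \<and> L = zspan S"
    then obtain S T U where *: "I = zspan S" "J = zspan T" "L = zspan U" by blast
    have "{s * t |s t. s \<in> {s * t |s t. s \<in> S \<and> t \<in> T} \<and> t \<in> U} =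
          {s * t |s t. s \<in> S \<and> t \<in> {s * t |s t. s \<in> T \<and> t \<in> U}}"
      (is "?A = ?B")
    proof
      show "?A \<subseteq> ?B"
      proof
        fix x assume "x \<in> ?A"
        then obtain s t u where "x = s * t * u" "s \<in> S" "t \<in> T" "u \<in> U" by blast
        then show "x \<in> ?B" using mult.assoc[of s t u] by blast
      qed
      show "?B \<subseteq> ?A"
      proof
        fix x assume "x \<in> ?B"
        then obtain s t u where "x = s * (t * u)" "s \<in> S" "t \<in> T" "u \<in> U" by blast
        then show "x \<in> ?A" using mult.assoc[of s t u, symmetric] by blast
      qed
    qed
    then show "zspan {x * y |x y. x \<in> zspan {x * y |x y. x \<in> I \<and> y \<in> J} \<and> y \<in> L} =
          zspan {x * y |x y. x \<in> I \<and> y \<in> zspan {x * y |x y. x \<in> J \<and> y \<in> L}}"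
      unfolding * zspan_mult_span by simp
  qed
  have comm: "I * J = J * I" for I J :: "'a frac_ideal"
  proof transfer
    fix I J :: "'a fract set"
    have "{x * y |x y. x \<in> I \<and> y \<in> J} = {x * y |x y. x \<in> J \<and> y \<in> I}"
      using mult.commute by blast
    then show "zspan {x * y |x y. x \<in> I \<and> y \<in> J} = zspan {x * y |x y. x \<in> J \<and> y \<in> I}"
      by simp
  qed
  then show "I * J = J * I" .
  show "1 * I = I"
  proof transfer
    fix I :: "'a fract set"
    assume "\<exists>S. finite S \<and> I = zspan S"
    then obtain S where *: "I = zspan S" by blast
    have 1: "range to_fract = zspan {1 :: 'a fract}"
      by (simp add: zmod.span_singleton)
    show "zspan {x * y |x y. x \<in> range to_fract \<and> y \<in> I} = I"
      unfolding * 1 zspan_mult_span by simp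
  qed
  show "(I + J) * L = I * L + J * L"
  proof transfer
    fix I J L :: "'a fract set"
    assume "\<exists>S. finite S \<and> I = zspan S" "\<exists>S. finite S \<and> J = zspan S" "\<exists>S. finite S \<and> L = zspan S"
    then obtain S T U where *: "I = zspan S" "J = zspan T" "L = zspan U" by blast
    have "{s * t |s t. s \<in> S \<union> T \<and> t \<in> U} =
      {s * t |s t. s \<in> S \<and> t \<in> U} \<union> {s * t |s t. s \<in> T \<and> t \<in> U}" by blast
    then show "zspan {x * y |x y. x \<in> {x + y |x y. x \<in> I \<and> y \<in> J} \<and> y \<in> L} =
       {x + y |x y. x \<in> zspan {x * y |x y. x \<in> I \<and> y \<in> L} \<and> y \<in> zspan {x * y |x y. x \<in> J \<and> y \<in> L}}"
      unfolding * zmod.span_Un[symmetric] zspan_mult_span by simp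
  qed
  show "0 * I = 0"
  proof transfer
    fix I :: "'a fract set"
    assume "\<exists>S. finite S \<and> I = zspan S"
    have "zspan {x * y |x y. x \<in> {0} \<and> y \<in> I} \<subseteq> {0}"
      by (rule zmod.span_minimal) auto
    then show "zspan {x * y |x y. x \<in> {0} \<and> y \<in> I} = {0}"
      using zmod.span_zero by blast
  qed
  then show "I * 0 = 0"
    by (simp only: comm)
  show "(0 :: 'a frac_ideal) \<noteq> 1"
    by transfer (metis rangeI singletonD to_fract_1 zero_neq_one)
  show "I < J \<longleftrightarrow> I \<le> J \<and> \<not> J \<le> I"
    by transfer blast
  show "I \<le> I"
    by transfer blast
  show "I \<le> J \<Longrightarrow> J \<le> L \<Longrightarrow> I \<le> L"
    by transfer blast
  show "I \<le> J \<Longrightarrow> J \<le> I \<Longrightarrow> I = J"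
    by transfer blast
qed

end

text \<open>A fractional ideal is invertible iff it is a unit of the semiring of fractional ideals.\<close>

abbreviation fi_invertible :: "'a::idom frac_ideal \<Rightarrow> bool" where
  "fi_invertible I \<equiv> I dvd 1"

text \<open>Unspecified if \<open>I\<close> is not invertible.\<close>

definition fi_inverse :: "'a::idom frac_ideal \<Rightarrow> 'a frac_ideal" where
  "fi_inverse I = (THE J. I * J = 1)"

lemma fi_inverse_unique:
  assumes "I * J = 1"
  shows "fi_inverse I = J"
  unfolding fi_inverse_def
proof (rule the_equality)
  show "I * J = 1" by (rule assms)
next
  fix L assume L: "I * L = 1"
  have "L = L * (I * J)" using assms by simp
  also have "\<dots> = (I * L) * J" by (simp only: ac_simps)
  finally show "L = J" using L by simp
qed

lemma fi_mult_inverse: "fi_invertible I \<Longrightarrow> I * fi_inverse I = 1"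
proof -
  assume "fi_invertible I"
  then obtain J where "1 = I * J" by (rule dvdE)
  then show ?thesis using fi_inverse_unique[of I J] by metis
qed

text \<open>The finitely generated ideals of the domain are the fractional ideals \<open>I \<le> 1\<close>, that is,
  those contained in the image of the domain in its field of fractions.\<close>

definition prufer_domain :: "'a::idom itself \<Rightarrow> bool" where
  "prufer_domain _ \<longleftrightarrow> (\<forall>I :: 'a frac_ideal. I \<noteq> 0 \<and> I \<le> 1 \<longrightarrow> fi_invertible I)"

section \<open>Pseudo-matrices\<close>

context
  notes [[typedef_overloaded]]
begin

datatype ('a::idom) pmat =
  PMat (row_ideals: "'a frac_ideal list") (col_ideals: "'a frac_ideal list") (entries: "'a fract mat")

end

text \<open>For a fraction \<open>x\<close> and a fractional ideal \<open>I\<close>, the fractional ideal \<open>x I\<close> is written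
  \<open>principal_fi x * I\<close>.  Indices start at 0.\<close>

definition pseudo_matrix :: "'a::idom pmat \<Rightarrow> bool" where
  "pseudo_matrix M \<longleftrightarrow>
     entries M \<in> carrier_mat (length (row_ideals M)) (length (col_ideals M)) \<and>
     (\<forall>h \<in> set (row_ideals M). fi_invertible h) \<and>
     (\<forall>e \<in> set (col_ideals M). fi_invertible e) \<and>
     (\<forall>i < length (row_ideals M). \<forall>j < length (col_ideals M).
        principal_fi (entries M $$ (i, j)) * col_ideals M ! j \<le> row_ideals M ! i)"

text \<open>Meaningful only if \<^term>\<open>col_ideals M = row_ideals N\<close>.\<close>

definition pmat_mult :: "'a::idom pmat \<Rightarrow> 'a pmat \<Rightarrow> 'a pmat"  (infixl "\<cdot>\<^sub>p" 70) where
  "M \<cdot>\<^sub>p N = PMat (row_ideals M) (col_ideals N) (entries M * entries N)"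

text \<open>The pseudo-matrix \<open>[M | N]\<close>, meaningful only if \<^term>\<open>row_ideals M = row_ideals N\<close>.\<close>

definition pmat_append_cols :: "'a::idom pmat \<Rightarrow> 'a pmat \<Rightarrow> 'a pmat"  (infixr "|\<^sub>p" 65) where
  "M |\<^sub>p N = PMat (row_ideals M) (col_ideals M @ col_ideals N)
     (mat (length (row_ideals M)) (length (col_ideals M) + length (col_ideals N))
       (\<lambda>(i, j). if j < length (col_ideals M) then entries M $$ (i, j)
                 else entries N $$ (i, j - length (col_ideals M))))"

definition det_ideal :: "'a::idom pmat \<Rightarrow> 'a frac_ideal" where
  "det_ideal M =
     principal_fi (det (entries M)) * prod_list (col_ideals M) * fi_inverse (prod_list (row_ideals M))"

definition incr_lists :: "nat \<Rightarrow> nat \<Rightarrow> nat list set" where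
  "incr_lists r n = {is. length is = r \<and> sorted_wrt (<) is \<and> set is \<subseteq> {..<n}}"

lemma finite_incr_lists [simp]: "finite (incr_lists r n)"
  by (rule finite_subset[OF _ finite_lists_length_eq[of "{..<n}" r]]) (auto simp: incr_lists_def)

definition minor_ideal :: "'a::idom pmat \<Rightarrow> nat list \<Rightarrow> nat list \<Rightarrow> 'a frac_ideal" where
  "minor_ideal M \<beta> \<alpha> =
     principal_fi (det (mat (length \<beta>) (length \<alpha>) (\<lambda>(i, j). entries M $$ (\<beta> ! i, \<alpha> ! j)))) *
     (\<Prod>j\<leftarrow>\<alpha>. col_ideals M ! j) * fi_inverse (\<Prod>i\<leftarrow>\<beta>. row_ideals M ! i)"

definition determinantal_ideal :: "int \<Rightarrow> 'a::idom pmat \<Rightarrow> 'a frac_ideal" where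
  "determinantal_ideal r M =
     (let n = length (row_ideals M); m = length (col_ideals M) in
      if r \<le> 0 then 1
      else if r > int (min m n) then 0
      else \<Sum>(\<beta>, \<alpha>) \<in> incr_lists (nat r) n \<times> incr_lists (nat r) m. minor_ideal M \<beta> \<alpha>)"

end

(* Every minor ideal is integral, by the Leibniz formula and the inclusions defining a
   pseudo-matrix; with Cramer's rule this gives the square case.
   If AX = B, expanding a minor of [A | B] along the column B expresses it as a combination,
   with coefficients x_j, of minors of A, so the determinantal ideals agree.  Conversely, let
   k be the largest order with D_k(A) nonzero.  Each nonzero minor of order k gives a Cramer
   solution over K, because the minors of order k+1 of [A | B] vanish.  Multiplied by its
   denominator, which is the minor d_p itself, it consists of minors of [A | B], which are
   controlled by D_k([A | B]) = D_k(A).  This ideal is invertible, whence a relation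
   1 = sum_p c_p d_p with c_p in a suitable ideal, and the corresponding affine combination of
   the Cramer solutions is an integral solution. *)

theory Submission
  imports Defs
begin

section \<open>The ordered semiring of fractional ideals\<close>

lemma fi_le_iff: "I \<le> J \<longleftrightarrow> fi_set I \<subseteq> fi_set J"
  by (simp add: less_eq_frac_ideal.rep_eq)

lemma subspace_fi_set: "zmod.subspace (fi_set I)"
  using fi_set[of I] by auto

lemma zspan_fi_set [simp]: "zspan (fi_set I) = fi_set I"
  using subspace_fi_set[of I] by simp

lemma fi_zero: "0 \<in> fi_set I"
  and fi_add: "x \<in> fi_set I \<Longrightarrow> y \<in> fi_set I \<Longrightarrow> x + y \<in> fi_set I"
  and fi_neg: "x \<in> fi_set I \<Longrightarrow> - x \<in> fi_set I"
  and fi_sum: "(\<And>p. p \<in> P \<Longrightarrow> f p \<in> fi_set I) \<Longrightarrow> (\<Sum>p\<in>P. f p) \<in> fi_set I"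
  using zmod.subspace_0[OF subspace_fi_set] zmod.subspace_add[OF subspace_fi_set]
    zmod.subspace_neg[OF subspace_fi_set] zmod.subspace_sum[OF subspace_fi_set] by blast+

text \<open>The sum is the join for containment, so J = I + J whenever I is contained in J, and J
  itself is the summand asked for. The class makes 0 the least ideal and each term of a finite sum
  at most the sum, which is how minor ideals are compared with determinantal ideals.\<close>

instance frac_ideal :: (idom) canonically_ordered_monoid_add
proof
  fix I J :: "'a frac_ideal"
  show "I \<le> J \<longleftrightarrow> (\<exists>L. J = I + L)"
  proof
    assume le: "I \<le> J"
    have "fi_set J = fi_set (I + J)"
      unfolding plus_frac_ideal.rep_eq
    proof (intro equalityI subsetI)
      fix x assume "x \<in> fi_set J"
      then show "x \<in> {x + y |x y. x \<in> fi_set I \<and> y \<in> fi_set J}"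
        using fi_zero[of I] by (metis (mono_tags, lifting) add_0 mem_Collect_eq)
    next
      fix x assume "x \<in> {x + y |x y. x \<in> fi_set I \<and> y \<in> fi_set J}"
      then show "x \<in> fi_set J" using le fi_add by (auto simp: fi_le_iff)
    qed
    then show "\<exists>L. J = I + L" by (auto simp: fi_set_inject)
  next
    assume "\<exists>L. J = I + L"
    then obtain L where J: "J = I + L" by blast
    show "I \<le> J" unfolding fi_le_iff J plus_frac_ideal.rep_eq
    proof
      fix x assume "x \<in> fi_set I"
      then show "x \<in> {x + y |x y. x \<in> fi_set I \<and> y \<in> fi_set L}"
        using fi_zero[of L] by (metis (mono_tags, lifting) add.right_neutral mem_Collect_eq)
    qed
  qed
qed

instance frac_ideal :: (idom) ordered_comm_semiring
proof
  fix I J L :: "'a frac_ideal"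
  assume "I \<le> J"
  then show "L * I \<le> L * J"
    by (metis distrib_left le_iff_add)
qed

lemma fi_sum_le:
  fixes J :: "'a::idom frac_ideal"
  assumes "\<And>p. p \<in> P \<Longrightarrow> I p \<le> J"
  shows "(\<Sum>p\<in>P. I p) \<le> J"
  using assms
proof (induction P rule: infinite_finite_induct)
  case (insert p P)
  then have "I p \<le> J" "(\<Sum>p\<in>P. I p) \<le> J" by auto
  with insert.hyps show ?case
    by (auto simp: fi_le_iff plus_frac_ideal.rep_eq intro!: fi_add)
qed simp_all

lemma fi_prod_mono:
  fixes I J :: "'b \<Rightarrow> 'a::idom frac_ideal"
  assumes "\<And>p. p \<in> P \<Longrightarrow> I p \<le> J p"
  shows "(\<Prod>p\<in>P. I p) \<le> (\<Prod>p\<in>P. J p)"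
  using assms by (induction P rule: infinite_finite_induct) (auto intro!: mult_mono)

section \<open>Principal fractional ideals\<close>

lemma fi_set_principal_mult: "fi_set (principal_fi x * I) = (*) x ` fi_set I"
proof -
  have "fi_set (principal_fi x * I) = zspan {s * t |s t. s \<in> zspan {x} \<and> t \<in> zspan (fi_set I)}"
    by (simp add: times_frac_ideal.rep_eq principal_fi.rep_eq)
  also have "\<dots> = zspan {s * t |s t. s \<in> {x} \<and> t \<in> fi_set I}"
    by (rule zspan_mult_span)
  also have "{s * t |s t. s \<in> {x} \<and> t \<in> fi_set I} = (*) x ` fi_set I"
    by auto
  also have "zspan \<dots> = (*) x ` fi_set I"
  proof -
    \<comment> \<open>The multiples by x of a submodule again form a submodule, so the span in the
      product of ideals adds nothing to the image.\<close>
    have "zmod.subspace ((*) x ` fi_set I)"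
    proof (rule zmod.subspaceI)
      show "0 \<in> (*) x ` fi_set I" using fi_zero[of I] by force
      show "y + z \<in> (*) x ` fi_set I" if "y \<in> (*) x ` fi_set I" "z \<in> (*) x ` fi_set I" for y z
        using that fi_add[of _ I] by (auto simp: image_iff simp flip: distrib_left)
      show "to_fract c * y \<in> (*) x ` fi_set I" if "y \<in> (*) x ` fi_set I" for c y
        using that zmod.subspace_scale[OF subspace_fi_set[of I]]
        by (force simp: mult.left_commute[of x])
    qed
    then show ?thesis by simp
  qed
  finally show ?thesis .
qed

lemma principal_mult_le_iff:
  "principal_fi x * I \<le> J \<longleftrightarrow> (\<forall>y\<in>fi_set I. x * y \<in> fi_set J)"
  by (auto simp: fi_le_iff fi_set_principal_mult)

lemma principal_le_iff: "principal_fi x \<le> J \<longleftrightarrow> x \<in> fi_set J"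
proof -
  have "zspan {x} \<subseteq> fi_set J \<longleftrightarrow> x \<in> fi_set J"
    using zmod.span_minimal[OF _ subspace_fi_set, of "{x}" J] zmod.span_base[of x "{x}"] by blast
  then show ?thesis by (simp add: fi_le_iff principal_fi.rep_eq)
qed

lemma principal_fi_1 [simp]: "principal_fi 1 = 1"
  by (auto simp flip: fi_set_inject simp: principal_fi.rep_eq one_frac_ideal.rep_eq zmod.span_singleton)

lemma principal_fi_0 [simp]: "principal_fi 0 = 0"
  by (auto simp flip: fi_set_inject simp: principal_fi.rep_eq zero_frac_ideal.rep_eq zmod.span_singleton)

lemma principal_fi_mult: "principal_fi (x * y) = principal_fi x * principal_fi y"
proof -
  have "fi_set (principal_fi (x * y) * 1) = fi_set (principal_fi x * (principal_fi y * 1))"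
    unfolding fi_set_principal_mult by (auto simp: image_image mult.assoc)
  then show ?thesis by (simp add: fi_set_inject)
qed

text \<open>Makes the signs of permutations disappear on passing to ideals, both in the Leibniz
  formula and when index lists are sorted.\<close>

lemma principal_fi_minus [simp]: "principal_fi (- x) = principal_fi x"
  by (rule antisym) (metis fi_neg order_refl principal_le_iff minus_minus)+

lemma principal_fi_prod: "principal_fi (\<Prod>p\<in>P. f p) = (\<Prod>p\<in>P. principal_fi (f p))"
  by (induction P rule: infinite_finite_induct) (auto simp: principal_fi_mult)

lemma principal_fi_eq_0_iff [simp]: "principal_fi x = 0 \<longleftrightarrow> x = 0"
proof
  assume "principal_fi x = 0"
  then have "x \<in> fi_set 0" using principal_le_iff[of x 0] by simp
  then show "x = 0" by (simp add: zero_frac_ideal.rep_eq)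
qed simp

lemma principal_sum_mult_le:
  assumes "\<And>p. p \<in> P \<Longrightarrow> principal_fi (f p) * I \<le> J"
  shows "principal_fi (\<Sum>p\<in>P. f p) * I \<le> J"
  using assms by (auto simp: principal_mult_le_iff sum_distrib_right intro!: fi_sum)

text \<open>Turns membership of 1 in a sum of ideals into an actual relation between elements, which
  supplies the coefficients of the integral solution.\<close>

lemma fi_set_sum_elim:
  assumes "finite P" "x \<in> fi_set (\<Sum>p\<in>P. I p)"
  obtains f where "\<And>p. p \<in> P \<Longrightarrow> f p \<in> fi_set (I p)" "x = (\<Sum>p\<in>P. f p)"
  using assms
proof (induction P arbitrary: x thesis)
  case empty
  then show ?case by (auto simp: zero_frac_ideal.rep_eq)
next
  case (insert p P)
  then obtain y z where yz: "x = y + z" "y \<in> fi_set (I p)" "z \<in> fi_set (\<Sum>p\<in>P. I p)"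
    by (auto simp: plus_frac_ideal.rep_eq)
  obtain f where f: "\<And>p. p \<in> P \<Longrightarrow> f p \<in> fi_set (I p)" "z = (\<Sum>p\<in>P. f p)"
    using insert.IH yz(3) by blast
  show ?case
  proof (rule insert.prems(1)[of "f(p := y)"])
    show "x = (\<Sum>q\<in>insert p P. (f(p := y)) q)"
      using insert.hyps f yz by (auto intro!: sum.cong)
  qed (use f yz in auto)
qed

section \<open>Inverses and cancellation\<close>

lemma fi_inverse_mult: "fi_invertible I \<Longrightarrow> fi_inverse I * I = 1"
  using fi_mult_inverse[of I] by (simp add: mult.commute)

lemma fi_invertible_inverse: "fi_invertible I \<Longrightarrow> fi_invertible (fi_inverse I)"
  by (rule dvdI[of _ _ I]) (simp add: fi_inverse_mult)

text \<open>Clears the denominator of a minor ideal, so that later estimates compare products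
  without inverses.\<close>

lemma fi_mult_inverse_le_iff:
  assumes "fi_invertible (J::'a::idom frac_ideal)"
  shows "I * fi_inverse J \<le> L \<longleftrightarrow> I \<le> L * J"
proof
  assume "I * fi_inverse J \<le> L"
  then have "(I * fi_inverse J) * J \<le> L * J" by (rule mult_right_mono) simp
  then show "I \<le> L * J" using assms by (simp add: mult.assoc fi_inverse_mult)
next
  assume "I \<le> L * J"
  then have "I * fi_inverse J \<le> (L * J) * fi_inverse J" by (rule mult_right_mono) simp
  then show "I * fi_inverse J \<le> L" using assms by (simp add: mult.assoc fi_mult_inverse)
qed

lemma fi_mult_le_cancel:
  assumes "fi_invertible (J::'a::idom frac_ideal)"
  shows "I * J \<le> L * J \<longleftrightarrow> I \<le> L"
  using fi_mult_inverse_le_iff[OF assms, of "I * J" L] assms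
  by (simp add: mult.assoc fi_mult_inverse)

lemma fi_mult_eq_0_iff:
  assumes "fi_invertible (J::'a::idom frac_ideal)"
  shows "I * J = 0 \<longleftrightarrow> I = 0"
  using fi_mult_le_cancel[OF assms, of I 0] by auto

lemma fi_invertible_prod_list:
  fixes Is :: "'a::idom frac_ideal list"
  assumes "\<And>I. I \<in> set Is \<Longrightarrow> fi_invertible I"
  shows "fi_invertible (prod_list Is)"
  using assms by (induction Is) auto

section \<open>Minors along arbitrary lists of indices\<close>

text \<open>In the Leibniz term of a permutation \<open>p\<close>, the entry in position
  \<open>(i, p i)\<close> carries \<open>es ! p i\<close> into \<open>hs ! i\<close>, and reindexing
  along \<open>p\<close> recovers the full product of \<open>es\<close>. The lists of ideals are
  free parameters because the square case applies this to a matrix with one column ideal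
  replaced.\<close>

lemma det_mult_prod_le:
  fixes C :: "'a::idom fract mat"
  assumes C: "C \<in> carrier_mat n n"
    and len: "length es = n" "length hs = n"
    and le: "\<And>i j. i < n \<Longrightarrow> j < n \<Longrightarrow> principal_fi (C $$ (i, j)) * es ! j \<le> hs ! i"
  shows "principal_fi (det C) * prod_list es \<le> prod_list hs"
  unfolding det_def'[OF C] prod.list_conv_set_nth len
proof (rule principal_sum_mult_le)
  fix p assume "p \<in> {p. p permutes {0..<n}}"
  then have p: "p permutes {0..<n}" by simp
  have "principal_fi (signof p * (\<Prod>i=0..<n. C $$ (i, p i))) =
      (\<Prod>i=0..<n. principal_fi (C $$ (i, p i)))"
    by (auto simp: principal_fi_prod sign_def)
  moreover have "(\<Prod>j=0..<n. es ! j) = (\<Prod>i=0..<n. es ! p i)"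
    using prod.permute[OF p, of "(!) es"] by (simp add: comp_def)
  moreover have "p i < n" if "i < n" for i
    using permutes_in_image[OF p, of i] that by auto
  ultimately show "principal_fi (signof p * (\<Prod>i=0..<n. C $$ (i, p i))) * (\<Prod>j=0..<n. es ! j)
      \<le> (\<Prod>i=0..<n. hs ! i)"
    by (auto simp flip: prod.distrib intro!: fi_prod_mono le)
qed

text \<open>The index lists may be unsorted and may repeat entries: Cramer's rule and column
  expansions replace one index or put a new one in front, which leaves the increasing lists. An
  entry function in place of a matrix lets A and [A | B] share their minors.\<close>

definition minor_det :: "(nat \<Rightarrow> nat \<Rightarrow> 'b::comm_ring_1) \<Rightarrow> nat list \<Rightarrow> nat list \<Rightarrow> 'b" where
  "minor_det f \<beta> \<alpha> = det (mat (length \<beta>) (length \<alpha>) (\<lambda>(i, j). f (\<beta> ! i) (\<alpha> ! j)))"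

lemma minor_det_transpose:
  assumes "length \<beta> = length \<alpha>"
  shows "minor_det f \<beta> \<alpha> = minor_det (\<lambda>i j. f j i) \<alpha> \<beta>"
proof -
  let ?C = "mat (length \<beta>) (length \<alpha>) (\<lambda>(i, j). f (\<beta> ! i) (\<alpha> ! j))"
  have "?C\<^sup>T = mat (length \<alpha>) (length \<beta>) (\<lambda>(i, j). f (\<beta> ! j) (\<alpha> ! i))"
    by (rule eq_matI) auto
  moreover have "det ?C = det (?C\<^sup>T)"
    by (rule det_transpose[symmetric, of _ "length \<alpha>"]) (simp add: assms)
  ultimately show ?thesis by (simp add: minor_det_def)
qed

lemma minor_det_not_distinct:
  assumes len: "length \<beta> = length \<alpha>" and "\<not> distinct \<alpha>"
  shows "minor_det f \<beta> \<alpha> = 0"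
proof -
  let ?C = "mat (length \<beta>) (length \<alpha>) (\<lambda>(i, j). f (\<beta> ! i) (\<alpha> ! j))"
  obtain s t where st: "s < length \<alpha>" "t < length \<alpha>" "s \<noteq> t" "\<alpha> ! s = \<alpha> ! t"
    using assms(2) by (auto simp: distinct_conv_nth)
  have "det ?C = 0"
    by (rule det_identical_columns[of _ "length \<alpha>" s t]) (use len st in auto)
  then show ?thesis by (simp add: minor_det_def)
qed

lemma minor_det_mset_rows:
  assumes len: "length \<beta> = length \<alpha>" and ms: "mset \<gamma> = mset \<beta>"
  shows "minor_det f \<gamma> \<alpha> = minor_det f \<beta> \<alpha> \<or> minor_det f \<gamma> \<alpha> = - minor_det f \<beta> \<alpha>"
proof -
  let ?C = "mat (length \<beta>) (length \<alpha>) (\<lambda>(i, j). f (\<beta> ! i) (\<alpha> ! j))"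
  let ?n = "length \<beta>"
  obtain p where p: "p permutes {..<?n}" and \<gamma>: "permute_list p \<beta> = \<gamma>"
    using ms by (rule mset_eq_permutation)
  have lt: "p i < ?n" if "i < ?n" for i
    using permutes_in_image[OF p, of i] that by auto
  have "mat (length \<gamma>) (length \<alpha>) (\<lambda>(i, j). f (\<gamma> ! i) (\<alpha> ! j)) =
      mat ?n ?n (\<lambda>(i, j). ?C $$ (p i, j))"
    using len lt by (auto simp flip: \<gamma> simp: permute_list_nth[OF p] intro!: eq_matI)
  then have "minor_det f \<gamma> \<alpha> = signof p * minor_det f \<beta> \<alpha>"
    using det_permute_rows[of ?C ?n p] p len
    by (simp add: minor_det_def atLeast0LessThan)
  then show ?thesis by (auto simp: sign_def)
qed

text \<open>Rearranged rows contribute the sign of a permutation; columns are treated as rows of the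
  transposed minor.\<close>

lemma minor_det_mset:
  assumes "length \<beta> = length \<alpha>" "mset \<gamma> = mset \<beta>" "mset \<delta> = mset \<alpha>"
  shows "minor_det f \<gamma> \<delta> = minor_det f \<beta> \<alpha> \<or> minor_det f \<gamma> \<delta> = - minor_det f \<beta> \<alpha>"
proof -
  have len: "length \<gamma> = length \<beta>" "length \<delta> = length \<alpha>"
    using assms by (metis mset_eq_length)+
  have "minor_det f \<gamma> \<delta> = minor_det f \<gamma> \<alpha> \<or> minor_det f \<gamma> \<delta> = - minor_det f \<gamma> \<alpha>"
    using minor_det_mset_rows[of \<alpha> \<gamma> \<delta> "\<lambda>i j. f j i"] assms len
      minor_det_transpose[of \<gamma> \<delta> f] minor_det_transpose[of \<gamma> \<alpha> f] by simp
  moreover have "minor_det f \<gamma> \<alpha> = minor_det f \<beta> \<alpha> \<or> minor_det f \<gamma> \<alpha> = - minor_det f \<beta> \<alpha>"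
    using minor_det_mset_rows assms by blast
  ultimately show ?thesis by auto
qed

text \<open>In the Laplace expansion along column \<open>t\<close> the cofactors do not see that
  column, so changing the index at \<open>t\<close> alters only the entries, in which the expansion
  is linear.\<close>

lemma minor_det_column_sum:
  assumes len: "length \<beta> = length \<alpha>" and t: "t < length \<alpha>"
    and col: "\<And>i. i \<in> set \<beta> \<Longrightarrow> f i (\<alpha> ! t) = (\<Sum>j\<in>J. c j * f i j)"
  shows "minor_det f \<beta> \<alpha> = (\<Sum>j\<in>J. c j * minor_det f \<beta> (\<alpha>[t := j]))"
proof -
  let ?n = "length \<alpha>"
  let ?C = "\<lambda>\<delta>. mat (length \<beta>) (length \<alpha>) (\<lambda>(i, j). f (\<beta> ! i) (\<delta> ! j))"
  have exp: "minor_det f \<beta> \<delta> = (\<Sum>i<?n. f (\<beta> ! i) (\<delta> ! t) * cofactor (?C \<delta>) i t)"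
    if "length \<delta> = ?n" for \<delta>
    unfolding minor_det_def
    by (subst laplace_expansion_column[of _ ?n t]) (use that len t in auto)
  have cof: "cofactor (?C (\<alpha>[t := j])) i t = cofactor (?C \<alpha>) i t" if "i < ?n" for i j
  proof -
    have "mat_delete (?C (\<alpha>[t := j])) i t = mat_delete (?C \<alpha>) i t"
      by (rule eq_matI) (use len t that in \<open>auto simp: mat_delete_def\<close>)
    then show ?thesis by (simp add: cofactor_def)
  qed
  have "minor_det f \<beta> \<alpha> = (\<Sum>i<?n. (\<Sum>j\<in>J. c j * f (\<beta> ! i) j) * cofactor (?C \<alpha>) i t)"
    by (subst exp) (auto intro!: sum.cong simp: col len)
  also have "\<dots> = (\<Sum>j\<in>J. c j * (\<Sum>i<?n. f (\<beta> ! i) j * cofactor (?C \<alpha>) i t))"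
    by (simp add: sum_distrib_right sum_distrib_left mult.assoc sum.swap[of _ J])
  also have "\<dots> = (\<Sum>j\<in>J. c j * minor_det f \<beta> (\<alpha>[t := j]))"
    by (simp add: exp cof t)
  finally show ?thesis .
qed

section \<open>Cramer's rule and bordered minors\<close>

lemma det_nonzero_solution:
  fixes C :: "'b::field mat"
  assumes C: "C \<in> carrier_mat n n" and d: "det C \<noteq> 0" and v: "v \<in> carrier_vec n"
  obtains y where "y \<in> carrier_vec n" "C *\<^sub>v y = v"
proof -
  obtain D where D: "D \<in> carrier_mat n n" "C * D = 1\<^sub>m n"
    using det_non_zero_imp_unit[OF C d, of n] by (auto simp: Units_def ring_mat_def)
  have "C *\<^sub>v (D *\<^sub>v v) = v"
    using C D v by (simp flip: assoc_mult_mat_vec)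
  moreover have "D *\<^sub>v v \<in> carrier_vec n" using D v by simp
  ultimately show ?thesis using that by blast
qed

text \<open>The rows \<open>\<beta>\<close> and columns \<open>\<alpha>\<close> determine a solution
  \<open>y\<close> over the field. The bordered minor is the defect of \<open>y\<close> in row
  \<open>i\<close> times the nonzero minor, so its vanishing makes \<open>y\<close> satisfy row
  \<open>i\<close> as well. Clearing the denominator leaves an identity between minors.\<close>

lemma cramer_bordered:
  fixes f :: "nat \<Rightarrow> nat \<Rightarrow> 'b::field"
  assumes len: "length \<beta> = length \<alpha>" and d: "minor_det f \<beta> \<alpha> \<noteq> 0"
    and bord: "minor_det f (i # \<beta>) (m # \<alpha>) = 0"
  shows "(\<Sum>t<length \<alpha>. f i (\<alpha> ! t) * minor_det f \<beta> (\<alpha>[t := m])) = minor_det f \<beta> \<alpha> * f i m"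
proof -
  let ?n = "length \<alpha>"
  define C where "C = mat ?n ?n (\<lambda>(i, j). f (\<beta> ! i) (\<alpha> ! j))"
  define v where "v = vec ?n (\<lambda>i. f (\<beta> ! i) m)"
  have C: "C \<in> carrier_mat ?n ?n" and dC: "minor_det f \<beta> \<alpha> = det C"
    by (simp_all add: C_def minor_det_def len)
  have v: "v \<in> carrier_vec ?n" by (simp add: v_def)
  obtain y where y: "y \<in> carrier_vec ?n" "C *\<^sub>v y = v"
    using det_nonzero_solution[OF C _ v] d dC by metis
  have y_minor: "minor_det f \<beta> (\<alpha>[t := m]) = y $ t * det C" if t: "t < ?n" for t
  proof -
    have "mat (length \<beta>) (length (\<alpha>[t := m])) (\<lambda>(i, j). f (\<beta> ! i) (\<alpha>[t := m] ! j)) =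
        replace_col C v t"
      by (rule eq_matI) (auto simp: replace_col_def C_def v_def len nth_list_update)
    then show ?thesis
      using cramer_lemma_mat[OF C y(1) t] y(2) by (simp add: minor_det_def)
  qed
  have y_row: "(\<Sum>t<?n. f (\<beta> ! s) (\<alpha> ! t) * y $ t) = f (\<beta> ! s) m" if s: "s < ?n" for s
  proof -
    have "(C *\<^sub>v y) $ s = (\<Sum>t<?n. f (\<beta> ! s) (\<alpha> ! t) * y $ t)"
      using s y(1) by (auto simp: C_def scalar_prod_def atLeast0LessThan intro!: sum.cong)
    then show ?thesis using y(2) s by (simp add: v_def)
  qed
  \<comment> \<open>The bordered matrix \<open>M\<close> sends \<open>z = (1, - y)\<close> to \<open>(\<delta>, 0, \<dots>, 0)\<close>, and Cramer's rule
    for the first component gives \<open>\<delta> det C = det M = 0\<close>.\<close>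
  define \<delta> where "\<delta> = f i m - (\<Sum>t<?n. f i (\<alpha> ! t) * y $ t)"
  define M where "M = mat (Suc ?n) (Suc ?n) (\<lambda>(s, t). f ((i # \<beta>) ! s) ((m # \<alpha>) ! t))"
  define z where "z = vec (Suc ?n) (\<lambda>t. case t of 0 \<Rightarrow> 1 | Suc t \<Rightarrow> - y $ t)"
  define w where "w = vec (Suc ?n) (\<lambda>s. case s of 0 \<Rightarrow> \<delta> | Suc s \<Rightarrow> 0)"
  have M: "M \<in> carrier_mat (Suc ?n) (Suc ?n)" and z: "z \<in> carrier_vec (Suc ?n)"
    by (simp_all add: M_def z_def)
  have Mz: "M *\<^sub>v z = w"
  proof (rule eq_vecI)
    fix s assume "s < dim_vec w"
    then have s: "s < Suc ?n" by (simp add: w_def)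
    have "(M *\<^sub>v z) $ s = (\<Sum>t=0..<Suc ?n. f ((i # \<beta>) ! s) ((m # \<alpha>) ! t) * z $ t)"
      using s z by (auto simp: M_def scalar_prod_def intro!: sum.cong)
    also have "\<dots> = f ((i # \<beta>) ! s) m - (\<Sum>t<?n. f ((i # \<beta>) ! s) (\<alpha> ! t) * y $ t)"
      by (subst sum.atLeast0_lessThan_Suc_shift) (simp add: z_def atLeast0LessThan sum_negf)
    also have "\<dots> = w $ s"
      using s y_row by (cases s) (auto simp: w_def \<delta>_def)
    finally show "(M *\<^sub>v z) $ s = w $ s" .
  qed (simp add: M_def w_def)
  have "det (replace_col M w 0) = 0"
    using cramer_lemma_mat[OF M z, of 0] bord len by (simp add: Mz minor_det_def flip: M_def)
  moreover have "det (replace_col M w 0) = \<delta> * det C"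
  proof -
    have R: "replace_col M w 0 \<in> carrier_mat (Suc ?n) (Suc ?n)"
      using M by (simp add: replace_col_def)
    have "mat_delete (replace_col M w 0) 0 0 = C"
      by (rule eq_matI) (auto simp: mat_delete_def replace_col_def M_def C_def)
    then have cof: "cofactor (replace_col M w 0) 0 0 = det C" by (simp add: cofactor_def)
    have "replace_col M w 0 $$ (s, 0) = w $ s" if "s < Suc ?n" for s
      using that by (simp add: replace_col_def M_def)
    moreover have w0: "w $ 0 = \<delta>" by (simp add: w_def)
    moreover have wS: "w $ Suc s = 0" if "s < ?n" for s
      using that by (simp add: w_def)
    ultimately show ?thesis
      by (subst laplace_expansion_column[OF R, of 0])
        (simp_all del: sum.lessThan_Suc add: sum.lessThan_Suc_shift cof w0 wS)
  qed
  ultimately have "\<delta> = 0" using d dC by simp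
  then have "f i m = (\<Sum>t<?n. f i (\<alpha> ! t) * y $ t)" by (simp add: \<delta>_def)
  then show ?thesis
    by (simp add: y_minor dC sum_distrib_left mult_ac)
qed

lemma minor_det_cong:
  assumes "\<And>i j. i \<in> set \<beta> \<Longrightarrow> j \<in> set \<alpha> \<Longrightarrow> f i j = g i j"
  shows "minor_det f \<beta> \<alpha> = minor_det g \<beta> \<alpha>"
proof -
  have "mat (length \<beta>) (length \<alpha>) (\<lambda>(i, j). f (\<beta> ! i) (\<alpha> ! j)) =
      mat (length \<beta>) (length \<alpha>) (\<lambda>(i, j). g (\<beta> ! i) (\<alpha> ! j))"
    by (rule eq_matI) (auto simp: assms)
  then show ?thesis by (simp add: minor_det_def)
qed

text \<open>Replacing a factor is phrased without division, so that it applies directly to products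
  of ideals.\<close>

lemma prod_list_update_mult:
  fixes xs :: "'b::comm_monoid_mult list"
  assumes "t < length xs"
  shows "prod_list (xs[t := y]) * xs ! t = prod_list xs * y"
  using assms
proof (induction xs arbitrary: t)
  case (Cons x xs)
  show ?case
  proof (cases t)
    case 0
    then show ?thesis by (simp add: mult_ac)
  next
    case (Suc s)
    then show ?thesis using Cons by (simp add: mult.assoc)
  qed
qed simp

lemma prod_list_map_mset:
  fixes g :: "'c \<Rightarrow> 'b::comm_monoid_mult"
  assumes "mset \<gamma> = mset \<alpha>"
  shows "prod_list (map g \<gamma>) = prod_list (map g \<alpha>)"
  using assms by (simp flip: prod_mset_prod_list)

section \<open>Determinantal ideals\<close>

lemma minor_ideal_minor_det:
  "minor_ideal M \<beta> \<alpha> = principal_fi (minor_det (\<lambda>i j. entries M $$ (i, j)) \<beta> \<alpha>) *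
     (\<Prod>j\<leftarrow>\<alpha>. col_ideals M ! j) * fi_inverse (\<Prod>i\<leftarrow>\<beta>. row_ideals M ! i)"
  by (simp add: minor_ideal_def minor_det_def)

lemma incr_lists_0 [simp]: "incr_lists 0 n = {[]}"
  by (auto simp: incr_lists_def)

lemma incr_lists_empty:
  assumes "n < r"
  shows "incr_lists r n = {}"
proof -
  have False if ks: "ks \<in> incr_lists r n" for ks
  proof -
    have "length ks = card (set ks)"
      using ks by (simp add: incr_lists_def strict_sorted_iff distinct_card)
    also have "\<dots> \<le> card {..<n}"
      using ks by (intro card_mono) (auto simp: incr_lists_def)
    finally show False using ks assms by (simp add: incr_lists_def)
  qed
  then show ?thesis by blast
qed

text \<open>The sum also covers the special cases of the definition: it is empty if
  \<open>r\<close> is too large, and for \<open>r = 0\<close> its only term is the minor ideal of the empty matrix.\<close>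

lemma determinantal_ideal_of_nat:
  "determinantal_ideal (int r) M =
     (\<Sum>(\<beta>, \<alpha>) \<in> incr_lists r (length (row_ideals M)) \<times> incr_lists r (length (col_ideals M)).
        minor_ideal M \<beta> \<alpha>)"
proof (cases "r = 0")
  case True
  have "fi_inverse 1 = (1::'a frac_ideal)" by (rule fi_inverse_unique) simp
  then show ?thesis using True by (simp add: determinantal_ideal_def minor_ideal_def)
next
  case False
  have "incr_lists r (length (row_ideals M)) \<times> incr_lists r (length (col_ideals M)) = {}"
    if "min (length (row_ideals M)) (length (col_ideals M)) < r"
    using that incr_lists_empty[of _ r] by (auto simp: min_less_iff_disj)
  then have "(\<Sum>(\<beta>, \<alpha>) \<in> incr_lists r (length (row_ideals M)) \<times> incr_lists r (length (col_ideals M)).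
      minor_ideal M \<beta> \<alpha>) = 0"
    if "min (length (row_ideals M)) (length (col_ideals M)) < r"
    using that by (simp only: sum.empty)
  with False show ?thesis by (auto simp: determinantal_ideal_def Let_def)
qed

text \<open>Sorting the indices changes a minor at most by a sign, which its ideal ignores, and a
  repeated index makes the minor 0. Hence the bound passes from the increasing lists of the
  definition to arbitrary ones.\<close>

lemma minor_ideal_le_determinantal_ideal:
  assumes len: "length \<beta> = r" "length \<alpha> = r"
    and \<beta>: "set \<beta> \<subseteq> {..<length (row_ideals M)}"
    and \<alpha>: "set \<alpha> \<subseteq> {..<length (col_ideals M)}"
  shows "minor_ideal M \<beta> \<alpha> \<le> determinantal_ideal (int r) M"
proof (cases "distinct \<beta> \<and> distinct \<alpha>")
  case True
  let ?f = "\<lambda>i j. entries M $$ (i, j)"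
  let ?P = "incr_lists r (length (row_ideals M)) \<times> incr_lists r (length (col_ideals M))"
  have "minor_det ?f (sort \<beta>) (sort \<alpha>) = minor_det ?f \<beta> \<alpha> \<or>
      minor_det ?f (sort \<beta>) (sort \<alpha>) = - minor_det ?f \<beta> \<alpha>"
    by (rule minor_det_mset) (simp_all add: len)
  then have "minor_ideal M \<beta> \<alpha> = minor_ideal M (sort \<beta>) (sort \<alpha>)"
    unfolding minor_ideal_minor_det
    using prod_list_map_mset[of "sort \<beta>" \<beta> "(!) (row_ideals M)"]
      prod_list_map_mset[of "sort \<alpha>" \<alpha> "(!) (col_ideals M)"] by auto
  moreover have "(sort \<beta>, sort \<alpha>) \<in> ?P"
    using True len \<beta> \<alpha> by (simp add: incr_lists_def strict_sorted_iff)
  then have "minor_ideal M (sort \<beta>) (sort \<alpha>) \<le> determinantal_ideal (int r) M"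
    unfolding determinantal_ideal_of_nat
    using member_le_sum[of "(sort \<beta>, sort \<alpha>)" ?P "\<lambda>(\<beta>, \<alpha>). minor_ideal M \<beta> \<alpha>"] by simp
  ultimately show ?thesis by simp
next
  case False
  then have "minor_det (\<lambda>i j. entries M $$ (i, j)) \<beta> \<alpha> = 0"
    using minor_det_not_distinct[of \<beta> \<alpha> "\<lambda>i j. entries M $$ (i, j)"]
      minor_det_not_distinct[of \<alpha> \<beta> "\<lambda>i j. entries M $$ (j, i)"]
      minor_det_transpose[of \<beta> \<alpha> "\<lambda>i j. entries M $$ (i, j)"] len by auto
  then show ?thesis by (simp add: minor_ideal_minor_det)
qed

lemma nth_less_if_set_subset:
  assumes "set xs \<subseteq> {..<n::nat}" "i < length xs"
  shows "xs ! i < n"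
  using assms nth_mem by blast

lemma fi_invertible_prod_nth:
  fixes Is :: "'a::idom frac_ideal list"
  assumes "\<And>I. I \<in> set Is \<Longrightarrow> fi_invertible I" "set \<alpha> \<subseteq> {..<length Is}"
  shows "fi_invertible (\<Prod>j\<leftarrow>\<alpha>. Is ! j)"
  by (rule fi_invertible_prod_list) (use assms in auto)

text \<open>The Pruefer hypothesis concerns ideals inside the domain; integrality is what allows it
  to be applied to a nonzero determinantal ideal.\<close>

lemma determinantal_ideal_le_1:
  assumes M: "pseudo_matrix M"
  shows "determinantal_ideal (int r) M \<le> 1"
  unfolding determinantal_ideal_of_nat
proof (rule fi_sum_le, clarify)
  fix \<beta> \<alpha>
  assume "\<beta> \<in> incr_lists r (length (row_ideals M))" "\<alpha> \<in> incr_lists r (length (col_ideals M))"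
  then have len: "length \<beta> = r" "length \<alpha> = r"
    and ran: "set \<beta> \<subseteq> {..<length (row_ideals M)}" "set \<alpha> \<subseteq> {..<length (col_ideals M)}"
    by (auto simp: incr_lists_def)
  have "principal_fi (minor_det (\<lambda>i j. entries M $$ (i, j)) \<beta> \<alpha>) * (\<Prod>j\<leftarrow>\<alpha>. col_ideals M ! j)
      \<le> (\<Prod>i\<leftarrow>\<beta>. row_ideals M ! i)"
    unfolding minor_det_def
  proof (rule det_mult_prod_le[of _ r])
    fix i j assume "i < r" "j < r"
    moreover from this have "\<beta> ! i < length (row_ideals M)" "\<alpha> ! j < length (col_ideals M)"
      using len ran by (auto intro: nth_less_if_set_subset)
    ultimately show "principal_fi (mat (length \<beta>) (length \<alpha>)
          (\<lambda>(i, j). entries M $$ (\<beta> ! i, \<alpha> ! j)) $$ (i, j)) * map ((!) (col_ideals M)) \<alpha> ! j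
        \<le> map ((!) (row_ideals M)) \<beta> ! i"
      using M len by (simp add: pseudo_matrix_def)
  qed (use len in auto)
  moreover have "fi_invertible (\<Prod>i\<leftarrow>\<beta>. row_ideals M ! i)"
    using M ran by (intro fi_invertible_prod_nth) (auto simp: pseudo_matrix_def)
  ultimately show "minor_ideal M \<beta> \<alpha> \<le> 1"
    by (simp add: minor_ideal_minor_det fi_mult_inverse_le_iff)
qed

section \<open>Linear systems\<close>

locale pseudo_system =
  fixes hs es :: "'a::idom frac_ideal list" and b :: "'a frac_ideal" and A0 B0 :: "'a fract mat"
  assumes A: "pseudo_matrix (PMat hs es A0)" and B: "pseudo_matrix (PMat hs [b] B0)"
begin

text \<open>The column of B gets the index \<open>length es\<close>, matching the position of
  \<open>b\<close> in \<open>es @ [b]\<close>. Minors of A are then literally those minors of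
  [A | B] whose column indices stay below \<open>length es\<close>.\<close>

definition entry :: "nat \<Rightarrow> nat \<Rightarrow> 'a fract" where
  "entry i j = (if j < length es then A0 $$ (i, j) else B0 $$ (i, 0))"

abbreviation H :: "nat list \<Rightarrow> 'a frac_ideal" where
  "H \<beta> \<equiv> (\<Prod>i\<leftarrow>\<beta>. hs ! i)"

abbreviation E :: "nat list \<Rightarrow> 'a frac_ideal" where
  "E \<alpha> \<equiv> (\<Prod>j\<leftarrow>\<alpha>. (es @ [b]) ! j)"

abbreviation D :: "nat \<Rightarrow> 'a frac_ideal" where
  "D r \<equiv> determinantal_ideal (int r) (PMat hs es A0)"

abbreviation D' :: "nat \<Rightarrow> 'a frac_ideal" where
  "D' r \<equiv> determinantal_ideal (int r) (PMat hs es A0 |\<^sub>p PMat hs [b] B0)"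

lemma A0: "A0 \<in> carrier_mat (length hs) (length es)"
  and B0: "B0 \<in> carrier_mat (length hs) 1"
  and invertible_hs: "h \<in> set hs \<Longrightarrow> fi_invertible h"
  and invertible_es: "e \<in> set es \<Longrightarrow> fi_invertible e"
  and invertible_b: "fi_invertible b"
  and A_le: "i < length hs \<Longrightarrow> j < length es \<Longrightarrow> principal_fi (A0 $$ (i, j)) * es ! j \<le> hs ! i"
  using A B by (auto simp: pseudo_matrix_def)

lemma invertible_H: "set \<beta> \<subseteq> {..<length hs} \<Longrightarrow> fi_invertible (H \<beta>)"
  using invertible_hs by (rule fi_invertible_prod_nth)

lemma invertible_E: "set \<alpha> \<subseteq> {..<Suc (length es)} \<Longrightarrow> fi_invertible (E \<alpha>)"
  using invertible_es invertible_b by (intro fi_invertible_prod_nth) auto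

lemma minor_ideal_A:
  assumes "set \<alpha> \<subseteq> {..<length es}"
  shows "minor_ideal (PMat hs es A0) \<beta> \<alpha> =
    principal_fi (minor_det entry \<beta> \<alpha>) * E \<alpha> * fi_inverse (H \<beta>)"
proof -
  have "minor_det (\<lambda>i j. A0 $$ (i, j)) \<beta> \<alpha> = minor_det entry \<beta> \<alpha>"
    using assms by (intro minor_det_cong) (auto simp: entry_def)
  moreover have "map ((!) es) \<alpha> = map ((!) (es @ [b])) \<alpha>"
    using assms by (auto simp: nth_append)
  ultimately show ?thesis unfolding minor_ideal_minor_det by (simp only: pmat.sel)
qed

lemma minor_ideal_AB:
  assumes "set \<beta> \<subseteq> {..<length hs}" "set \<alpha> \<subseteq> {..<Suc (length es)}"
  shows "minor_ideal (PMat hs es A0 |\<^sub>p PMat hs [b] B0) \<beta> \<alpha> =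
    principal_fi (minor_det entry \<beta> \<alpha>) * E \<alpha> * fi_inverse (H \<beta>)"
proof -
  have "minor_det (\<lambda>i j. entries (PMat hs es A0 |\<^sub>p PMat hs [b] B0) $$ (i, j)) \<beta> \<alpha> =
      minor_det entry \<beta> \<alpha>"
  proof (rule minor_det_cong)
    fix i j assume "i \<in> set \<beta>" "j \<in> set \<alpha>"
    with assms have "i < length hs" "j < Suc (length es)" by auto
    then show "entries (PMat hs es A0 |\<^sub>p PMat hs [b] B0) $$ (i, j) = entry i j"
      by (auto simp: entry_def pmat_append_cols_def less_Suc_eq)
  qed
  then show ?thesis unfolding minor_ideal_minor_det by (simp add: pmat_append_cols_def)
qed

lemma minor_le_D:
  assumes "length \<beta> = r" "length \<alpha> = r" "set \<beta> \<subseteq> {..<length hs}" "set \<alpha> \<subseteq> {..<length es}"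
  shows "principal_fi (minor_det entry \<beta> \<alpha>) * E \<alpha> \<le> D r * H \<beta>"
  using minor_ideal_le_determinantal_ideal[of \<beta> r \<alpha> "PMat hs es A0"] assms
  by (simp add: minor_ideal_A fi_mult_inverse_le_iff invertible_H)

lemma minor_le_D':
  assumes "length \<beta> = r" "length \<alpha> = r" "set \<beta> \<subseteq> {..<length hs}" "set \<alpha> \<subseteq> {..<Suc (length es)}"
  shows "principal_fi (minor_det entry \<beta> \<alpha>) * E \<alpha> \<le> D' r * H \<beta>"
  using minor_ideal_le_determinantal_ideal[of \<beta> r \<alpha> "PMat hs es A0 |\<^sub>p PMat hs [b] B0"] assms
  by (simp add: minor_ideal_AB fi_mult_inverse_le_iff invertible_H)
    (simp add: pmat_append_cols_def)

lemma D_le_D': "D r \<le> D' r"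
  unfolding determinantal_ideal_of_nat[of r "PMat hs es A0"]
proof (rule fi_sum_le, clarsimp)
  fix \<beta> \<alpha>
  assume "\<beta> \<in> incr_lists r (length hs)" "\<alpha> \<in> incr_lists r (length es)"
  then have *: "length \<beta> = r" "length \<alpha> = r" "set \<beta> \<subseteq> {..<length hs}" "set \<alpha> \<subseteq> {..<length es}"
    by (auto simp: incr_lists_def)
  then have "set \<alpha> \<subseteq> {..<Suc (length es)}" by auto
  with * show "minor_ideal (PMat hs es A0) \<beta> \<alpha> \<le> D' r"
    by (simp add: minor_ideal_A fi_mult_inverse_le_iff invertible_H minor_le_D')
qed

section \<open>A solution forces equal determinantal ideals\<close>

lemma E_update:
  assumes "t < length \<alpha>"
  shows "E (\<alpha>[t := j]) * (es @ [b]) ! (\<alpha> ! t) = E \<alpha> * (es @ [b]) ! j"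
  using prod_list_update_mult[of t "map ((!) (es @ [b])) \<alpha>" "(es @ [b]) ! j"] assms
  by (simp add: map_update)

text \<open>Replacing the column of B by column j of A trades \<open>b\<close> for
  \<open>es ! j\<close> in the product of column ideals. The integrality of \<open>x j\<close>
  compensates exactly this exchange, after which the invertible factor \<open>es ! j\<close>
  cancels.\<close>

lemma solution_imp_D'_le_D:
  assumes xb: "\<And>j. j < length es \<Longrightarrow> principal_fi (x j) * b \<le> es ! j"
    and sol: "\<And>i. i < length hs \<Longrightarrow> entry i (length es) = (\<Sum>j<length es. x j * entry i j)"
  shows "D' r \<le> D r"
  unfolding determinantal_ideal_of_nat[of r "PMat hs es A0 |\<^sub>p PMat hs [b] B0"]
proof (rule fi_sum_le, clarify)
  fix \<beta> \<alpha>
  assume "\<beta> \<in> incr_lists r (length (row_ideals (PMat hs es A0 |\<^sub>p PMat hs [b] B0)))"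
    "\<alpha> \<in> incr_lists r (length (col_ideals (PMat hs es A0 |\<^sub>p PMat hs [b] B0)))"
  then have len: "length \<beta> = r" "length \<alpha> = r" and \<beta>: "set \<beta> \<subseteq> {..<length hs}"
    and \<alpha>: "set \<alpha> \<subseteq> {..<Suc (length es)}" "distinct \<alpha>"
    by (auto simp: incr_lists_def strict_sorted_iff pmat_append_cols_def)
  have "principal_fi (minor_det entry \<beta> \<alpha>) * E \<alpha> \<le> D r * H \<beta>"
  proof (cases "length es \<in> set \<alpha>")
    case False
    with \<alpha>(1) have "set \<alpha> \<subseteq> {..<length es}" by (auto simp: less_Suc_eq)
    then show ?thesis using len \<beta> by (intro minor_le_D)
  next
    case True
    then obtain t where t: "t < length \<alpha>" "\<alpha> ! t = length es" by (auto simp: in_set_conv_nth)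
    have "minor_det entry \<beta> \<alpha> = (\<Sum>j<length es. x j * minor_det entry \<beta> (\<alpha>[t := j]))"
      by (rule minor_det_column_sum) (use len t \<beta> sol in auto)
    moreover have "principal_fi (x j * minor_det entry \<beta> (\<alpha>[t := j])) * E \<alpha> \<le> D r * H \<beta>"
      if "j \<in> {..<length es}" for j
    proof -
      have j: "j < length es" using that by simp
      \<comment> \<open>Since \<open>\<alpha>\<close> is distinct, the index of B occurs only at
        \<open>t\<close>, so only columns of A remain. The index j may now occur twice, which
        \<open>minor_le_D\<close> permits.\<close>
      have "set (\<alpha>[t := j]) \<subseteq> {..<length es}"
        using \<alpha> t j by (auto simp: set_update_distinct less_Suc_eq)
      then have "principal_fi (minor_det entry \<beta> (\<alpha>[t := j])) * E (\<alpha>[t := j]) \<le> D r * H \<beta>"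
        using len \<beta> by (intro minor_le_D) simp_all
      then have "(principal_fi (x j) * b) *
          (principal_fi (minor_det entry \<beta> (\<alpha>[t := j])) * E (\<alpha>[t := j])) \<le> es ! j * (D r * H \<beta>)"
        by (rule mult_mono[OF xb[OF j] _ zero_le zero_le])
      also have "(principal_fi (x j) * b) *
          (principal_fi (minor_det entry \<beta> (\<alpha>[t := j])) * E (\<alpha>[t := j])) =
          principal_fi (x j * minor_det entry \<beta> (\<alpha>[t := j])) * (E (\<alpha>[t := j]) * b)"
        by (simp add: principal_fi_mult mult_ac)
      also have "E (\<alpha>[t := j]) * b = E \<alpha> * es ! j"
        using E_update[OF t(1), of j] t j by (simp add: nth_append)
      finally have "(principal_fi (x j * minor_det entry \<beta> (\<alpha>[t := j])) * E \<alpha>) * es ! j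
          \<le> (D r * H \<beta>) * es ! j"
        by (simp add: mult_ac)
      then show ?thesis
        using fi_mult_le_cancel[of "es ! j"] invertible_es j by simp
    qed
    ultimately show ?thesis by (simp only: principal_sum_mult_le)
  qed
  then show "minor_ideal (PMat hs es A0 |\<^sub>p PMat hs [b] B0) \<beta> \<alpha> \<le> D r"
    using \<beta> \<alpha> by (simp add: minor_ideal_AB fi_mult_inverse_le_iff invertible_H)
qed

section \<open>Equal determinantal ideals give a solution\<close>

lemma cramer_solution:
  assumes len: "length \<beta> = k" "length \<alpha> = k"
    and \<beta>: "set \<beta> \<subseteq> {..<length hs}" and \<alpha>: "set \<alpha> \<subseteq> {..<length es}"
    and vanish: "D' (Suc k) = 0"
  shows "\<exists>y. (\<forall>i<length hs. (\<Sum>j<length es. entry i j * y j) =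
        minor_det entry \<beta> \<alpha> * entry i (length es)) \<and>
      (\<forall>j<length es. principal_fi (y j) * (b * E \<alpha>) \<le> es ! j * (D' k * H \<beta>))"
proof (cases "minor_det entry \<beta> \<alpha> = 0")
  case True
  then show ?thesis by (intro exI[of _ "\<lambda>_. 0"]) simp
next
  case False
  let ?m = "length es"
  let ?d = "\<lambda>t. minor_det entry \<beta> (\<alpha>[t := ?m])"
  \<comment> \<open>These are the numerators of Cramer's rule: the one for position \<open>t\<close>
    belongs to column \<open>\<alpha> ! t\<close>, and columns outside \<open>\<alpha>\<close>
    receive 0. They solve the system with right-hand side multiplied by the minor.\<close>
  define y where "y = (\<lambda>j. \<Sum>t<k. if \<alpha> ! t = j then ?d t else 0)"
  have \<alpha>_lt: "\<alpha> ! t < ?m" if "t < k" for t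
    using that len \<alpha> by (auto intro: nth_less_if_set_subset)
  have "(\<Sum>j<?m. entry i j * y j) = minor_det entry \<beta> \<alpha> * entry i ?m" if i: "i < length hs" for i
  proof -
    \<comment> \<open>Bordering by row \<open>i\<close> and the column of B gives a minor of order k
      + 1 of [A | B]; \<open>i\<close> may already occur in \<open>\<beta>\<close>.\<close>
    have "principal_fi (minor_det entry (i # \<beta>) (?m # \<alpha>)) * E (?m # \<alpha>) \<le> D' (Suc k) * H (i # \<beta>)"
      by (rule minor_le_D') (use len \<alpha> \<beta> i in auto)
    then have "principal_fi (minor_det entry (i # \<beta>) (?m # \<alpha>)) * E (?m # \<alpha>) = 0"
      using vanish by simp
    moreover have "fi_invertible (E (?m # \<alpha>))"
      by (rule invertible_E) (use \<alpha> in auto)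
    ultimately have "minor_det entry (i # \<beta>) (?m # \<alpha>) = 0"
      using fi_mult_eq_0_iff principal_fi_eq_0_iff by blast
    then have "(\<Sum>t<k. entry i (\<alpha> ! t) * ?d t) = minor_det entry \<beta> \<alpha> * entry i ?m"
      using cramer_bordered[of \<beta> \<alpha> entry i ?m] False len by simp
    moreover have "(\<Sum>j<?m. entry i j * y j) = (\<Sum>t<k. \<Sum>j<?m. if \<alpha> ! t = j then entry i j * ?d t else 0)"
      unfolding y_def sum_distrib_left
      by (subst sum.swap) (auto intro!: sum.cong)
    moreover have "\<dots> = (\<Sum>t<k. entry i (\<alpha> ! t) * ?d t)"
      using \<alpha>_lt by (auto intro!: sum.cong)
    ultimately show ?thesis by simp
  qed
  moreover have "principal_fi (y j) * (b * E \<alpha>) \<le> es ! j * (D' k * H \<beta>)" if j: "j < ?m" for j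
    unfolding y_def
  proof (rule principal_sum_mult_le)
    fix t assume "t \<in> {..<k}"
    then have t: "t < k" by simp
    show "principal_fi (if \<alpha> ! t = j then ?d t else 0) * (b * E \<alpha>) \<le> es ! j * (D' k * H \<beta>)"
    proof (cases "\<alpha> ! t = j")
      case True
      have "set (\<alpha>[t := ?m]) \<subseteq> {..<Suc ?m}"
        using \<alpha> set_update_subset_insert[of \<alpha> t ?m] by auto
      then have "principal_fi (?d t) * E (\<alpha>[t := ?m]) \<le> D' k * H \<beta>"
        using len \<beta> by (intro minor_le_D') simp_all
      then have "es ! j * (principal_fi (?d t) * E (\<alpha>[t := ?m])) \<le> es ! j * (D' k * H \<beta>)"
        by (rule mult_left_mono) simp
      \<comment> \<open>Putting B in place of column j exchanges \<open>es ! j\<close> for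
        \<open>b\<close>, which is where the factor \<open>es ! j\<close> of the bound comes
        from.\<close>
      moreover have E: "E \<alpha> * b = E (\<alpha>[t := ?m]) * es ! j"
        using E_update[of t \<alpha> ?m] t len j True by (simp add: nth_append)
      have "principal_fi (?d t) * (b * E \<alpha>) = es ! j * (principal_fi (?d t) * E (\<alpha>[t := ?m]))"
        unfolding mult.commute[of b] E by (simp only: mult_ac)
      ultimately show ?thesis using True by (simp only: simp_thms if_True)
    qed simp
  qed
  ultimately show ?thesis by blast
qed

lemma solution_if_D'_eq_D:
  assumes prufer: "prufer_domain TYPE('a)" and eq: "\<And>r. D' r = D r"
  shows "\<exists>x. (\<forall>j<length es. principal_fi (x j) * b \<le> es ! j) \<and>
    (\<forall>i<length hs. (\<Sum>j<length es. entry i j * x j) = entry i (length es))"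
proof -
  let ?m = "length es"
  \<comment> \<open>There are too few rows for minors of this order, so a least order with zero
    ideal exists; it is positive because \<open>D 0 = 1\<close>. Its predecessor is k. If A is zero,
    then k = 0 and the only minor is the empty one, equal to 1.\<close>
  have "D (Suc (length hs)) = 0"
    unfolding determinantal_ideal_of_nat by (simp add: incr_lists_empty)
  define l where "l = (LEAST r. D r = 0)"
  have "D l = 0" unfolding l_def by (rule LeastI) fact
  moreover have "D 0 \<noteq> 0" by (simp add: determinantal_ideal_def)
  ultimately obtain k where k: "l = Suc k" by (cases l) auto
  have D0: "D (Suc k) = 0" using \<open>D l = 0\<close> k by simp
  have "D k \<noteq> 0" using not_less_Least[of k "\<lambda>r. D r = 0"] k by (simp add: l_def)
  then have inv: "fi_invertible (D k)"
    using prufer determinantal_ideal_le_1[OF A] unfolding prufer_domain_def by blast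
  define J where "J = fi_inverse (D k)"
  have DJ: "D k * J = 1" using inv by (simp add: J_def fi_mult_inverse)
  let ?P = "incr_lists k (length hs) \<times> incr_lists k ?m"
  let ?d = "\<lambda>p. minor_det entry (fst p) (snd p)"
  \<comment> \<open>The numerators of the Cramer solution for \<open>p\<close> carry
    \<open>b * E (snd p)\<close> into \<open>es ! j * (D k * H (fst p))\<close>. The ideal
    \<open>?L p\<close> is chosen so that a coefficient in it absorbs the factors other than
    \<open>b\<close> and \<open>es ! j\<close>.\<close>
  let ?L = "\<lambda>p. E (snd p) * fi_inverse (H (fst p)) * J"
  have P: "length (fst p) = k \<and> length (snd p) = k \<and>
      set (fst p) \<subseteq> {..<length hs} \<and> set (snd p) \<subseteq> {..<?m}" if "p \<in> ?P" for p
    using that by (auto simp: incr_lists_def)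
  \<comment> \<open>The hypothesis \<open>eq\<close> enters twice: in order k + 1 it makes the
    minors of [A | B] vanish, and in order k it bounds the numerators by \<open>D k\<close>.\<close>
  have "\<forall>p\<in>?P. \<exists>y. (\<forall>i<length hs. (\<Sum>j<?m. entry i j * y j) = ?d p * entry i ?m) \<and>
      (\<forall>j<?m. principal_fi (y j) * (b * E (snd p)) \<le> es ! j * (D k * H (fst p)))"
    using cramer_solution[of "fst p" k "snd p" for p] P unfolding eq D0 by blast
  then obtain y where
    y: "\<And>p i. p \<in> ?P \<Longrightarrow> i < length hs \<Longrightarrow> (\<Sum>j<?m. entry i j * y p j) = ?d p * entry i ?m"
    and yb: "\<And>p j. p \<in> ?P \<Longrightarrow> j < ?m \<Longrightarrow>
      principal_fi (y p j) * (b * E (snd p)) \<le> es ! j * (D k * H (fst p))"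
    unfolding bchoice_iff by blast
  \<comment> \<open>Expanding \<open>D k\<close> into minor ideals shows that 1 is a sum of elements
    \<open>?d p * c p\<close> with \<open>c p\<close> in \<open>?L p\<close>.\<close>
  have "D k * J = (\<Sum>p\<in>?P. principal_fi (?d p) * ?L p)"
    unfolding determinantal_ideal_of_nat sum_distrib_right
    by (rule sum.cong) (use P in \<open>auto simp: minor_ideal_A mult.assoc\<close>)
  then have "1 \<in> fi_set (\<Sum>p\<in>?P. principal_fi (?d p) * ?L p)"
    using DJ principal_le_iff[of 1 1] by simp
  then obtain g where g: "\<And>p. p \<in> ?P \<Longrightarrow> g p \<in> fi_set (principal_fi (?d p) * ?L p)"
    and g1: "1 = (\<Sum>p\<in>?P. g p)"
    by (rule fi_set_sum_elim[rotated]) auto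
  have "\<forall>p\<in>?P. \<exists>c. c \<in> fi_set (?L p) \<and> g p = ?d p * c"
    using g unfolding fi_set_principal_mult by blast
  then obtain c where c: "\<And>p. p \<in> ?P \<Longrightarrow> c p \<in> fi_set (?L p)"
    and gc: "\<And>p. p \<in> ?P \<Longrightarrow> g p = ?d p * c p"
    unfolding bchoice_iff by blast
  \<comment> \<open>Row i of A sends \<open>y p\<close> to \<open>?d p\<close> times the entry of B,
    and the numbers \<open>c p * ?d p\<close> add up to 1, so this combination solves the original
    system.\<close>
  define x where "x = (\<lambda>j. \<Sum>p\<in>?P. c p * y p j)"
  have "principal_fi (x j) * b \<le> es ! j" if j: "j < ?m" for j
    unfolding x_def
  proof (rule principal_sum_mult_le)
    fix p assume p: "p \<in> ?P"
    have HH: "H (fst p) * fi_inverse (H (fst p)) = 1"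
      using P[OF p] by (intro fi_mult_inverse invertible_H) blast
    have "principal_fi (c p * y p j) * b = principal_fi (c p) * (principal_fi (y p j) * b)"
      by (simp add: principal_fi_mult mult.assoc)
    also have "\<dots> \<le> ?L p * (principal_fi (y p j) * b)"
      using c[OF p] by (intro mult_right_mono) (simp_all add: principal_le_iff)
    also have "\<dots> = (principal_fi (y p j) * (b * E (snd p))) * (fi_inverse (H (fst p)) * J)"
      by (simp only: mult_ac)
    also have "\<dots> \<le> (es ! j * (D k * H (fst p))) * (fi_inverse (H (fst p)) * J)"
      using yb[OF p j] by (rule mult_right_mono) simp
    also have "\<dots> = es ! j * (D k * J) * (H (fst p) * fi_inverse (H (fst p)))"
      by (simp only: mult_ac)
    finally show "principal_fi (c p * y p j) * b \<le> es ! j" by (simp add: HH DJ)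
  qed
  moreover have "(\<Sum>j<?m. entry i j * x j) = entry i ?m" if i: "i < length hs" for i
  proof -
    have "(\<Sum>j<?m. entry i j * x j) = (\<Sum>p\<in>?P. c p * (\<Sum>j<?m. entry i j * y p j))"
      unfolding x_def sum_distrib_left by (subst sum.swap) (simp only: mult_ac)
    also have "\<dots> = (\<Sum>p\<in>?P. g p * entry i ?m)"
      by (rule sum.cong) (use y i gc in \<open>auto simp: mult_ac\<close>)
    also have "\<dots> = entry i ?m"
      by (simp flip: sum_distrib_right g1)
    finally show ?thesis .
  qed
  ultimately show ?thesis by blast
qed

section \<open>The equivalence in matrix form\<close>

lemma mult_eq_B0_iff:
  assumes X0: "X0 \<in> carrier_mat (length es) 1"
  shows "A0 * X0 = B0 \<longleftrightarrow>
    (\<forall>i<length hs. (\<Sum>j<length es. entry i j * X0 $$ (j, 0)) = entry i (length es))"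
proof -
  have prod: "(A0 * X0) $$ (i, 0) = (\<Sum>j<length es. entry i j * X0 $$ (j, 0))" if "i < length hs" for i
    using that A0 X0 by (auto simp: scalar_prod_def entry_def atLeast0LessThan intro!: sum.cong)
  have "A0 * X0 = B0 \<longleftrightarrow> (\<forall>i<length hs. (A0 * X0) $$ (i, 0) = B0 $$ (i, 0))"
    using A0 X0 B0 by (auto intro!: eq_matI)
  then show ?thesis using prod by (auto simp: entry_def)
qed

lemma pseudo_matrix_solution_iff:
  assumes X0: "X0 \<in> carrier_mat (length es) 1"
  shows "pseudo_matrix (PMat es [b] X0) \<longleftrightarrow>
    (\<forall>j<length es. principal_fi (X0 $$ (j, 0)) * b \<le> es ! j)"
  using X0 invertible_es invertible_b by (auto simp: pseudo_matrix_def)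

theorem solvable_iff_determinantal_ideals:
  assumes prufer: "prufer_domain TYPE('a)"
  shows "(\<exists>X. pseudo_matrix X \<and> row_ideals X = es \<and> col_ideals X = [b] \<and>
      PMat hs es A0 \<cdot>\<^sub>p X = PMat hs [b] B0) \<longleftrightarrow>
    (\<forall>r. determinantal_ideal r (PMat hs es A0 |\<^sub>p PMat hs [b] B0) =
      determinantal_ideal r (PMat hs es A0))"
    (is "?sol \<longleftrightarrow> ?eq")
proof
  assume ?sol
  obtain X0 where pm: "pseudo_matrix (PMat es [b] X0)" and AX: "A0 * X0 = B0"
  proof -
    from \<open>?sol\<close> obtain X where "pseudo_matrix X" "row_ideals X = es" "col_ideals X = [b]"
      "PMat hs es A0 \<cdot>\<^sub>p X = PMat hs [b] B0" by blast
    then show thesis using that[of "entries X"] by (cases X) (simp add: pmat_mult_def)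
  qed
  then have X0: "X0 \<in> carrier_mat (length es) 1" by (simp add: pseudo_matrix_def)
  have "D' r \<le> D r" for r
  proof (rule solution_imp_D'_le_D)
    show "principal_fi (X0 $$ (j, 0)) * b \<le> es ! j" if "j < length es" for j
      using pm that by (simp only: pseudo_matrix_solution_iff[OF X0])
    show "entry i (length es) = (\<Sum>j<length es. X0 $$ (j, 0) * entry i j)" if "i < length hs" for i
      using AX that by (simp only: mult_eq_B0_iff[OF X0] mult.commute)
  qed
  then have D_eq: "D' r = D r" for r using D_le_D' by (intro antisym)
  show ?eq
  proof
    fix r :: int
    show "determinantal_ideal r (PMat hs es A0 |\<^sub>p PMat hs [b] B0) =
        determinantal_ideal r (PMat hs es A0)"
    \<comment> \<open>For nonpositive orders both ideals are 1 by definition; the other orders are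
      natural numbers, covered by \<open>D_eq\<close>.\<close>
    proof (cases "r \<le> 0")
      case True
      then show ?thesis by (simp add: determinantal_ideal_def)
    next
      case False
      then show ?thesis using D_eq[of "nat r"] by simp
    qed
  qed
next
  assume ?eq
  then obtain x where x: "\<And>j. j < length es \<Longrightarrow> principal_fi (x j) * b \<le> es ! j"
    "\<And>i. i < length hs \<Longrightarrow> (\<Sum>j<length es. entry i j * x j) = entry i (length es)"
    using solution_if_D'_eq_D[OF prufer] by blast
  define X0 where "X0 = mat (length es) 1 (\<lambda>(j, _). x j)"
  have X0: "X0 \<in> carrier_mat (length es) 1" by (simp add: X0_def)
  have "pseudo_matrix (PMat es [b] X0)" "A0 * X0 = B0"
    using x unfolding pseudo_matrix_solution_iff[OF X0] mult_eq_B0_iff[OF X0]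
    by (simp_all add: X0_def)
  then show ?sol
    by (intro exI[of _ "PMat es [b] X0"]) (simp add: pmat_mult_def)
qed

section \<open>The square case\<close>

lemma unique_solution:
  assumes sq: "length es = length hs" and d: "det A0 \<noteq> 0"
  shows "\<exists>!X0. X0 \<in> carrier_mat (length es) 1 \<and> A0 * X0 = B0"
proof -
  let ?n = "length hs"
  have A0': "A0 \<in> carrier_mat ?n ?n" using A0 sq by simp
  obtain C where C: "C \<in> carrier_mat ?n ?n" "A0 * C = 1\<^sub>m ?n" "C * A0 = 1\<^sub>m ?n"
    using det_non_zero_imp_unit[OF A0' d, of "()"] by (auto simp: Units_def ring_mat_def)
  have "A0 * (C * B0) = B0"
    using A0' B0 C by (simp flip: assoc_mult_mat)
  moreover have "X0 = C * B0" if X0: "X0 \<in> carrier_mat ?n 1" and "A0 * X0 = B0" for X0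
    using assoc_mult_mat[OF C(1) A0' X0] C that by simp
  moreover have "C * B0 \<in> carrier_mat ?n 1" using C B0 by simp
  ultimately show ?thesis using sq by auto
qed

text \<open>In the matrix of Cramer's rule for \<open>x\<^sub>j\<close>, the hypothesis on \<open>B\<close> allows the ideal of the
  replaced column to be \<open>b\<close> divided by the determinant ideal.\<close>

lemma square_solution_integral:
  assumes sq: "length es = length hs" and d: "det A0 \<noteq> 0"
    and B_le: "\<And>i. i < length hs \<Longrightarrow>
      minor_ideal (PMat hs [b] B0) [i] [0] \<le> det_ideal (PMat hs es A0)"
    and X0: "X0 \<in> carrier_mat (length es) 1" and AX: "A0 * X0 = B0"
    and j: "j < length es"
  shows "principal_fi (X0 $$ (j, 0)) * b \<le> es ! j"
proof -
  let ?n = "length hs"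
  let ?I = "det_ideal (PMat hs es A0)"
  let ?G = "principal_fi (det A0) * prod_list es"
  let ?C = "replace_col A0 (col B0 0) j"
  have A0': "A0 \<in> carrier_mat ?n ?n" using A0 sq by simp
  \<comment> \<open>A nonzero determinant generates an invertible ideal. Hence the determinant ideal
    can be inverted to form \<open>J\<close>, and \<open>?G\<close> can be cancelled at the
    end.\<close>
  have "principal_fi (det A0) * principal_fi (inverse (det A0)) = 1"
    using d by (simp flip: principal_fi_mult)
  then have "fi_invertible (principal_fi (det A0))" by (metis dvdI)
  moreover have "fi_invertible (prod_list es)" "fi_invertible (prod_list hs)"
    using invertible_es invertible_hs by (simp_all add: fi_invertible_prod_list)
  ultimately have inv: "fi_invertible ?G" "fi_invertible (prod_list hs)" "fi_invertible ?I"
    by (simp_all add: det_ideal_def fi_invertible_inverse)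
  have IH: "?I * prod_list hs = ?G"
    using fi_inverse_mult[OF inv(2)] by (simp add: det_ideal_def mult.assoc)
  define J where "J = fi_inverse ?I"
  have IJ: "J * ?I = 1" using inv(3) by (simp add: J_def fi_inverse_mult)
  have "principal_fi (det ?C) * prod_list (es[j := b * J]) \<le> prod_list hs"
  proof (rule det_mult_prod_le[of _ ?n])
    fix i l assume il: "i < ?n" "l < ?n"
    show "principal_fi (?C $$ (i, l)) * es[j := b * J] ! l \<le> hs ! i"
    proof (cases "l = j")
      case True
      \<comment> \<open>This is the hypothesis on the order-1 minor ideals of B with
        \<open>hs ! i\<close> moved to the right; dividing by \<open>?I\<close> then gives the
        inclusion required of the replaced column.\<close>
      have "principal_fi (B0 $$ (i, 0)) * b \<le> ?I * hs ! i"
        using B_le[OF il(1)] invertible_hs il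
        by (simp add: minor_ideal_def fi_mult_inverse_le_iff det_single)
      then have "principal_fi (B0 $$ (i, 0)) * b * J \<le> hs ! i"
        unfolding J_def using inv(3) by (simp add: fi_mult_inverse_le_iff mult.commute[of ?I])
      then show ?thesis
        using True il j A0 B0 sq by (simp add: replace_col_def mult.assoc)
    next
      case False
      then show ?thesis using il A0' A_le sq by (simp add: replace_col_def)
    qed
  qed (use A0' sq in \<open>auto simp: replace_col_def\<close>)
  moreover have detC: "det ?C = X0 $$ (j, 0) * det A0"
  proof -
    have "col X0 0 \<in> carrier_vec ?n" using X0 sq by (intro carrier_vecI) simp
    moreover    have "A0 *\<^sub>v col X0 0 = col B0 0"
      using col_mult2[OF A0 X0, of 0] AX by simp
    ultimately show ?thesis
      using cramer_lemma_mat[OF A0', of "col X0 0" j] X0 j sq by simp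
  qed
  ultimately have "principal_fi (X0 $$ (j, 0) * det A0) * prod_list (es[j := b * J]) \<le> prod_list hs"
    by (simp only: detC)
  \<comment> \<open>Multiplying by \<open>es ! j * ?I\<close> restores the factor missing from the
    product of \<open>es\<close> and removes \<open>J\<close>. Both sides become multiples of
    \<open>?G\<close>, whose cancellation leaves the claim.\<close>
  then have "principal_fi (X0 $$ (j, 0) * det A0) * prod_list (es[j := b * J]) * (es ! j * ?I)
      \<le> prod_list hs * (es ! j * ?I)"
    by (rule mult_right_mono) simp
  moreover have "principal_fi (X0 $$ (j, 0) * det A0) * prod_list (es[j := b * J]) * (es ! j * ?I)
      = principal_fi (X0 $$ (j, 0)) * b * ?G"
  proof -
    have "prod_list (es[j := b * J]) * (es ! j * ?I) = prod_list es * b * (J * ?I)"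
      using prod_list_update_mult[OF j, of "b * J"] by (simp flip: mult.assoc)
    then show ?thesis by (simp add: IJ principal_fi_mult mult_ac)
  qed
  moreover have "prod_list hs * (es ! j * ?I) = es ! j * ?G"
    unfolding IH[symmetric] by (simp only: mult_ac)
  ultimately show ?thesis using fi_mult_le_cancel[OF inv(1)] by simp
qed

end

theorem mainTheorem8:
  fixes hs es :: "'a::idom frac_ideal list" and b :: "'a frac_ideal"
    and A0 B0 :: "'a fract mat" and A B :: "'a pmat"
  assumes "prufer_domain TYPE('a)"
    and "A = PMat hs es A0" and "pseudo_matrix A"
    and "B = PMat hs [b] B0" and "pseudo_matrix B"
  shows "(length es = length hs \<and> det_ideal A \<noteq> 0 \<and>
            (\<forall>i < length hs. minor_ideal B [i] [0] \<le> det_ideal A) \<longrightarrow>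
          (\<exists>!X0. X0 \<in> carrier_mat (length es) 1 \<and> A0 * X0 = B0) \<and>
          (\<forall>X0 \<in> carrier_mat (length es) 1. A0 * X0 = B0 \<longrightarrow>
             pseudo_matrix (PMat es [b] X0) \<and>
             (\<forall>j < length es. principal_fi (X0 $$ (j, 0)) * b \<le> es ! j))) \<and>
         ((\<exists>X. pseudo_matrix X \<and> row_ideals X = es \<and> col_ideals X = [b] \<and> A \<cdot>\<^sub>p X = B) \<longleftrightarrow>
          (\<forall>r. determinantal_ideal r (A |\<^sub>p B) = determinantal_ideal r A))"
proof -
  interpret pseudo_system hs es b A0 B0
    using assms by unfold_locales simp_all
  show ?thesis
  proof (rule conjI, rule impI, elim conjE)
    assume sq: "length es = length hs" and "det_ideal A \<noteq> 0"
      and B_le: "\<forall>i < length hs. minor_ideal B [i] [0] \<le> det_ideal A"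
    then have d: "det A0 \<noteq> 0"
      by (auto simp: det_ideal_def assms(2))
    have "\<forall>j < length es. principal_fi (X0 $$ (j, 0)) * b \<le> es ! j"
      if "X0 \<in> carrier_mat (length es) 1" "A0 * X0 = B0" for X0
      using square_solution_integral[OF sq d _ that] B_le by (simp add: assms(2,4))
    then have "\<forall>X0 \<in> carrier_mat (length es) 1. A0 * X0 = B0 \<longrightarrow>
        pseudo_matrix (PMat es [b] X0) \<and>
        (\<forall>j < length es. principal_fi (X0 $$ (j, 0)) * b \<le> es ! j)"
      using pseudo_matrix_solution_iff by blast
    with unique_solution[OF sq d]
    show "(\<exists>!X0. X0 \<in> carrier_mat (length es) 1 \<and> A0 * X0 = B0) \<and>
      (\<forall>X0 \<in> carrier_mat (length es) 1. A0 * X0 = B0 \<longrightarrow>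
         pseudo_matrix (PMat es [b] X0) \<and>
         (\<forall>j < length es. principal_fi (X0 $$ (j, 0)) * b \<le> es ! j))"
      by (rule conjI)
  next
    show "(\<exists>X. pseudo_matrix X \<and> row_ideals X = es \<and> col_ideals X = [b] \<and> A \<cdot>\<^sub>p X = B) \<longleftrightarrow>
        (\<forall>r. determinantal_ideal r (A |\<^sub>p B) = determinantal_ideal r A)"
      unfolding assms(2,4) by (rule solvable_iff_determinantal_ideals[OF assms(1)])
  qed
qed

end
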